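(* Let $\mathcal{S}_{\min}$ be a minimal description of the restricted value function $z$. The local subdifferential of $z$ at $\zeta\in\mathcal{C}$ is given by $$\partial_Lz(\zeta)=\bigcap_{x_I\in\mathcal{S}_I^*(\zeta)\cap\mathcal{S}_{\min}}\mathcal{D}(\zeta-C_I^{1:\ell}x_I;\ b-A_Ix_I).$$
   Context: Data: $A\in\mathbb{Q}^{m\times n}$, $b\in\mathbb{Q}^m$, and $C\in\mathbb{Q}^{(\ell+1)\times n}$ with rows $c^0,c^1,\dots,c^\ell$; $C^{1:\ell}$ is the submatrix of $C$ with rows $c^1,\dots,c^\ell$. The first $r$ variables are integer and the last $n-r$ are continuous; a subscript $I$ (resp. $C$) on a matrix or row vector denotes its columns corresponding to the integer (resp. continuous) variables. $X_{\rm MO}=\{(x_I,x_C)\in\mathbb{Z}_+^r\times\mathbb{R}_+^{n-r}: A_Ix_I+A_Cx_C=b\}$ is assumed bounded. For $\zeta\in\mathbb{R}^\ell$ let $\mathcal{S}(\zeta)=\{(x_I,x_C)\in X_{\rm MO}: C_I^{1:\ell}x_I+C_C^{1:\ell}x_C\le\zeta\}$, $\mathcal{C}=\{\zeta:\mathcal{S}(\zeta)\ne\emptyset\}$, $z(\zeta)=\inf_{(x_I,x_C)\in\mathcal{S}(\zeta)}c^0_Ix_I+c^0_Cx_C$ ($+\infty$ for $\zeta\notin\mathcal{C}$). Let $\mathcal{S}_I(\zeta)=\{x_I:\exists x_C,(x_I,x_C)\in\mathcal{S}(\zeta)\}$ and $\mathcal{S}_I=\bigcup_{\zeta\in\mathcal{C}}\mathcal{S}_I(\zeta)$.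 Let $z_{\rm LP}(\zeta;\beta)=\inf\{c^0_Cx_C: C_C^{1:\ell}x_C\le\zeta,\ A_Cx_C=\beta,\ x_C\in\mathbb{R}_+^{n-r}\}$ ($+\infty$ if infeasible) and $\bar z(\zeta;x_I)=c^0_Ix_I+z_{\rm LP}(\zeta-C_I^{1:\ell}x_I;\ b-A_Ix_I)$ for $x_I\in\mathcal{S}_I$. Let $\mathcal{S}_I^*(\zeta)=\{x_I\in\mathcal{S}_I(\zeta):\bar z(\zeta;x_I)=z(\zeta)\}$. A description of $z$ is a set $\mathcal{S}\subseteq\mathcal{S}_I$ such that for every $\zeta\in\mathcal{C}$ there are $x_I\in\mathcal{S}$, $x_C\in\mathbb{R}^{n-r}_+$ with $(x_I,x_C)\in\mathcal{S}(\zeta)$ and $c^0_Ix_I+c^0_Cx_C=z(\zeta)$. It is minimal if no proper subset is a description. For $\eta\in\mathbb{R}^\ell$ and $\beta\in\mathbb{R}^m$ with $z_{\rm LP}(\eta;\beta)$ finite, $\mathcal{D}(\eta;\beta)=\{u\in\mathbb{R}^\ell_-:\exists v\in\mathbb{R}^m,\ (C_C^{1:\ell})^\top u+A_C^\top v\le c^0_C,\ \eta^\top u+\beta^\top v=z_{\rm LP}(\eta;\beta)\}$, the projection onto the $u$-variables of the set of optimal solutions of the dual LP. A vector $q\in\mathbb{R}^\ell$ is a local subgradient of $f$ at $\zeta'$ if there exists $\epsilon>0$ such that $f(\zeta)\ge f(\zeta')+q^\top(\zeta-\zeta')$ for all $\zeta\in\mathbb{R}^\ell$ with $\|\zeta-\zeta'\|\le\epsilon$;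 the local subdifferential $\partial_Lf(\zeta')$ is the set of all local subgradients of $f$ at $\zeta'$ (here $f=z$ may take the value $+\infty$ away from $\zeta'$). *)

theory Defs
  imports "Jordan_Normal_Form.Matrix" "HOL-Library.Extended_Real"
begin

text \<open>Vectors and matrices are those of \<open>Jordan_Normal_Form.Matrix\<close>, so that every dimension,
  including the numbers of integer and of continuous variables, may also be \<open>0\<close>.
  On vectors, \<open>\<le>\<close> is componentwise and entails equality of the dimensions.\<close>

definition nonneg_vecs :: "nat \<Rightarrow> real vec set" where
  "nonneg_vecs k = {x \<in> carrier_vec k. 0\<^sub>v k \<le> x}"

definition nonpos_vecs :: "nat \<Rightarrow> real vec set" where
  "nonpos_vecs k = {x \<in> carrier_vec k. x \<le> 0\<^sub>v k}"

definition nonneg_int_vecs :: "nat \<Rightarrow> real vec set" where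
  "nonneg_int_vecs k = {x \<in> nonneg_vecs k. set\<^sub>v x \<subseteq> \<int>}"

definition euclid_norm :: "real vec \<Rightarrow> real" where
  "euclid_norm x = sqrt (x \<bullet> x)"

definition local_subgradient :: "nat \<Rightarrow> (real vec \<Rightarrow> ereal) \<Rightarrow> real vec \<Rightarrow> real vec \<Rightarrow> bool" where
  "local_subgradient l f \<zeta>' q \<longleftrightarrow> q \<in> carrier_vec l \<and>
     (\<exists>\<epsilon>>0. \<forall>\<zeta>\<in>carrier_vec l. euclid_norm (\<zeta> - \<zeta>') \<le> \<epsilon> \<longrightarrow> f \<zeta> \<ge> f \<zeta>' + ereal (q \<bullet> (\<zeta> - \<zeta>')))"

definition local_subdifferential :: "nat \<Rightarrow> (real vec \<Rightarrow> ereal) \<Rightarrow> real vec \<Rightarrow> real vec set" where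
  "local_subdifferential l f \<zeta>' = {q. local_subgradient l f \<zeta>' q}"


text \<open>In \<open>cost_mat\<close>, row \<open>0\<close> is \<open>c\<^sup>0\<close> and the remaining \<open>\<ell>\<close> rows are \<open>c\<^sup>1, \<dots>, c\<^sup>\<ell>\<close>.\<close>

record mo_data =
  eq_mat :: "real mat"
  eq_rhs :: "real vec"
  cost_mat :: "real mat"
  num_int :: nat

abbreviation num_eqs :: "mo_data \<Rightarrow> nat" where
  "num_eqs P \<equiv> dim_row (eq_mat P)"

abbreviation num_vars :: "mo_data \<Rightarrow> nat" where
  "num_vars P \<equiv> dim_col (eq_mat P)"

abbreviation num_restr :: "mo_data \<Rightarrow> nat" where
  "num_restr P \<equiv> dim_row (cost_mat P) - 1"

abbreviation num_cont :: "mo_data \<Rightarrow> nat" where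
  "num_cont P \<equiv> num_vars P - num_int P"

text \<open>As \<open>num_restr P\<close> is a truncated difference, the condition on \<open>cost_mat\<close> also excludes a
  matrix without rows.\<close>

definition rational_mo_data :: "mo_data \<Rightarrow> bool" where
  "rational_mo_data P \<longleftrightarrow>
     eq_rhs P \<in> carrier_vec (num_eqs P) \<and>
     cost_mat P \<in> carrier_mat (num_restr P + 1) (num_vars P) \<and>
     num_int P \<le> num_vars P \<and>
     elements_mat (eq_mat P) \<subseteq> \<rat> \<and> set\<^sub>v (eq_rhs P) \<subseteq> \<rat> \<and> elements_mat (cost_mat P) \<subseteq> \<rat>"

definition int_cols :: "nat \<Rightarrow> real mat \<Rightarrow> real mat" where
  "int_cols r M = mat (dim_row M) r (\<lambda>(i, j). M $$ (i, j))"

definition cont_cols :: "nat \<Rightarrow> real mat \<Rightarrow> real mat" where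
  "cont_cols r M = mat (dim_row M) (dim_col M - r) (\<lambda>(i, j). M $$ (i, r + j))"

definition restr_mat :: "mo_data \<Rightarrow> real mat" where
  "restr_mat P = mat (num_restr P) (dim_col (cost_mat P)) (\<lambda>(i, j). cost_mat P $$ (i + 1, j))"

definition A\<^sub>I :: "mo_data \<Rightarrow> real mat" where
  "A\<^sub>I P = int_cols (num_int P) (eq_mat P)"

definition A\<^sub>C :: "mo_data \<Rightarrow> real mat" where
  "A\<^sub>C P = cont_cols (num_int P) (eq_mat P)"

definition C\<^sub>I :: "mo_data \<Rightarrow> real mat" where
  "C\<^sub>I P = int_cols (num_int P) (restr_mat P)"

definition C\<^sub>C :: "mo_data \<Rightarrow> real mat" where
  "C\<^sub>C P = cont_cols (num_int P) (restr_mat P)"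

definition c0\<^sub>I :: "mo_data \<Rightarrow> real vec" where
  "c0\<^sub>I P = row (int_cols (num_int P) (cost_mat P)) 0"

definition c0\<^sub>C :: "mo_data \<Rightarrow> real vec" where
  "c0\<^sub>C P = row (cont_cols (num_int P) (cost_mat P)) 0"

definition X_MO :: "mo_data \<Rightarrow> (real vec \<times> real vec) set" where
  "X_MO P = {(x\<^sub>I, x\<^sub>C). x\<^sub>I \<in> nonneg_int_vecs (num_int P) \<and> x\<^sub>C \<in> nonneg_vecs (num_cont P) \<and>
                A\<^sub>I P *\<^sub>v x\<^sub>I + A\<^sub>C P *\<^sub>v x\<^sub>C = eq_rhs P}"

definition bounded_X_MO :: "mo_data \<Rightarrow> bool" where
  "bounded_X_MO P \<longleftrightarrow> (\<exists>B. \<forall>(x\<^sub>I, x\<^sub>C) \<in> X_MO P. euclid_norm (x\<^sub>I @\<^sub>v x\<^sub>C) \<le> B)"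

definition feas_set :: "mo_data \<Rightarrow> real vec \<Rightarrow> (real vec \<times> real vec) set" where
  "feas_set P \<zeta> = {(x\<^sub>I, x\<^sub>C) \<in> X_MO P. C\<^sub>I P *\<^sub>v x\<^sub>I + C\<^sub>C P *\<^sub>v x\<^sub>C \<le> \<zeta>}"

definition feas_rhs :: "mo_data \<Rightarrow> real vec set" where
  "feas_rhs P = {\<zeta> \<in> carrier_vec (num_restr P). feas_set P \<zeta> \<noteq> {}}"

definition obj :: "mo_data \<Rightarrow> real vec \<Rightarrow> real vec \<Rightarrow> real" where
  "obj P x\<^sub>I x\<^sub>C = c0\<^sub>I P \<bullet> x\<^sub>I + c0\<^sub>C P \<bullet> x\<^sub>C"

text \<open>The infimum of the empty set in \<^typ>\<open>ereal\<close> is \<open>\<infinity>\<close>.\<close>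

definition restr_value :: "mo_data \<Rightarrow> real vec \<Rightarrow> ereal" where
  "restr_value P \<zeta> = (INF (x\<^sub>I, x\<^sub>C) \<in> feas_set P \<zeta>. ereal (obj P x\<^sub>I x\<^sub>C))"

definition int_parts_at :: "mo_data \<Rightarrow> real vec \<Rightarrow> real vec set" where
  "int_parts_at P \<zeta> = {x\<^sub>I. \<exists>x\<^sub>C. (x\<^sub>I, x\<^sub>C) \<in> feas_set P \<zeta>}"

definition int_parts :: "mo_data \<Rightarrow> real vec set" where
  "int_parts P = (\<Union>\<zeta> \<in> feas_rhs P. int_parts_at P \<zeta>)"

definition z_LP :: "mo_data \<Rightarrow> real vec \<Rightarrow> real vec \<Rightarrow> ereal" where
  "z_LP P \<eta> \<beta> =
     (INF x\<^sub>C \<in> {x\<^sub>C \<in> nonneg_vecs (num_cont P). C\<^sub>C P *\<^sub>v x\<^sub>C \<le> \<eta> \<and> A\<^sub>C P *\<^sub>v x\<^sub>C = \<beta>}.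
        ereal (c0\<^sub>C P \<bullet> x\<^sub>C))"

definition z_bar :: "mo_data \<Rightarrow> real vec \<Rightarrow> real vec \<Rightarrow> ereal" where
  "z_bar P \<zeta> x\<^sub>I =
     ereal (c0\<^sub>I P \<bullet> x\<^sub>I) + z_LP P (\<zeta> - C\<^sub>I P *\<^sub>v x\<^sub>I) (eq_rhs P - A\<^sub>I P *\<^sub>v x\<^sub>I)"

definition opt_int_parts :: "mo_data \<Rightarrow> real vec \<Rightarrow> real vec set" where
  "opt_int_parts P \<zeta> = {x\<^sub>I \<in> int_parts_at P \<zeta>. z_bar P \<zeta> x\<^sub>I = restr_value P \<zeta>}"

definition description :: "mo_data \<Rightarrow> real vec set \<Rightarrow> bool" where
  "description P S \<longleftrightarrow> S \<subseteq> int_parts P \<and>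
     (\<forall>\<zeta> \<in> feas_rhs P. \<exists>x\<^sub>I \<in> S. \<exists>x\<^sub>C \<in> nonneg_vecs (num_cont P).
        (x\<^sub>I, x\<^sub>C) \<in> feas_set P \<zeta> \<and> ereal (obj P x\<^sub>I x\<^sub>C) = restr_value P \<zeta>)"

definition minimal_description :: "mo_data \<Rightarrow> real vec set \<Rightarrow> bool" where
  "minimal_description P S \<longleftrightarrow> description P S \<and> (\<forall>S'. S' \<subset> S \<longrightarrow> \<not> description P S')"

text \<open>Projection onto the \<open>u\<close>-variables of the set of optimal dual solutions. The last equation
  holds only where \<^const>\<open>z_LP\<close> is finite; elsewhere the set is empty.\<close>

definition dual_opt_proj :: "mo_data \<Rightarrow> real vec \<Rightarrow> real vec \<Rightarrow> real vec set" where
  "dual_opt_proj P \<eta> \<beta> =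
     {u \<in> nonpos_vecs (num_restr P). \<exists>v \<in> carrier_vec (num_eqs P).
        transpose_mat (C\<^sub>C P) *\<^sub>v u + transpose_mat (A\<^sub>C P) *\<^sub>v v \<le> c0\<^sub>C P \<and>
        ereal (\<eta> \<bullet> u + \<beta> \<bullet> v) = z_LP P \<eta> \<beta>}"

end

theory Submission
  imports Defs
begin

text \<open>
  For a fixed integer part \<open>x\<^sub>I\<close>, the cost as a function of the right-hand side is the value function
  of a linear program, hence convex, and the value function \<open>z\<close> is the minimum of the finitely many
  such functions that belong to a description; finiteness is where boundedness of the
  feasible set enters. A local subgradient of such a minimum is a common local subgradient of the
  pieces that attain it, and for a convex piece a local subgradient is a global one. By linear
  programming duality, the subgradients of a piece are the \<open>u\<close>-parts of its optimal dual solutions.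

  \<^item> A local subgradient \<open>q\<close> of \<open>z\<close> is one for each attaining piece, since \<open>z\<close> lies below every
    piece. Convexity turns the local inequality into a lower bound for \<open>c\<^sup>0\<^sub>C x - q (C\<^sub>C x)\<close> over
    the polyhedron \<open>{x \<ge> 0. A\<^sub>C x = \<beta>}\<close> (\<open>local_subgradient_supports_lp\<close>), and a Farkas
    argument certifies this bound by some \<open>v\<close> (\<open>dual_certificate\<close>). The sign of \<open>q\<close> comes
    from monotonicity of \<open>z\<close>.

  \<^item> Conversely, weak duality makes an optimal dual solution support its own piece everywhere
    (\<open>dual_opt_proj_supports_obj\<close>). A piece that does not attain \<open>z(\<zeta>)\<close>, including one that is
    \<open>\<infinity>\<close> there, stays above the affine function on a neighbourhood of \<open>\<zeta>\<close>: the linear system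
    stating that the piece is at most \<open>z(\<zeta>)\<close> is infeasible, and a Farkas certificate of
    infeasibility survives small perturbations of the right-hand side
    (\<open>infeasible_system_stable\<close>, \<open>nonoptimal_int_part_locally_dominated\<close>).

  Both directions thus rest on one form of Farkas' lemma, which is proved by an elementary induction
  on the number of inequalities, without topology.
\<close>


section \<open>Farkas' lemma and certificates of infeasibility\<close>

text \<open>
  The induction on the number of functionals is due to Bartl. If the functional \<open>a k\<close> is needed, some
  \<open>x0\<close> violates the claim for the remaining ones, and then \<open>a k x0 > 0\<close>. Moving every point
  along \<open>x0\<close> into the kernel of \<open>a k\<close> reduces the problem to the remaining functionals.
  The argument combines points only in the form \<open>x + t y\<close>, so it asks merely for an operation
  \<open>comb\<close> on which all functionals act in this way; this lets \<open>V\<close> be a carrier set of vectors or a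
  product of such sets without a vector space structure on the type.
\<close>

lemma farkas_functionals:
  fixes a :: "'i \<Rightarrow> 'x \<Rightarrow> real" and g :: "'x \<Rightarrow> real" and comb :: "'x \<Rightarrow> real \<Rightarrow> 'x \<Rightarrow> 'x"
  assumes "finite I"
    and closed: "\<And>x t y. x \<in> V \<Longrightarrow> y \<in> V \<Longrightarrow> comb x t y \<in> V"
    and "\<And>i x t y. i \<in> I \<Longrightarrow> x \<in> V \<Longrightarrow> y \<in> V \<Longrightarrow> a i (comb x t y) = a i x + t * a i y"
    and "\<And>x t y. x \<in> V \<Longrightarrow> y \<in> V \<Longrightarrow> g (comb x t y) = g x + t * g y"
    and "\<And>x. x \<in> V \<Longrightarrow> (\<And>i. i \<in> I \<Longrightarrow> a i x \<le> 0) \<Longrightarrow> g x \<le> 0"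
  shows "\<exists>w. (\<forall>i\<in>I. 0 \<le> w i) \<and> (\<forall>x\<in>V. g x = (\<Sum>i\<in>I. w i * a i x))"
  using assms(1,3-5)
proof (induction I arbitrary: a g rule: finite_induct)
  case empty
  have "g x = 0" if "x \<in> V" for x
    using empty(2)[OF that that, of "-2"] empty(3)[OF that] empty(3)[OF closed[OF that that, of "-2"]]
    by simp
  then show ?case by simp
next
  case (insert k I)
  show ?case
  proof (cases "\<forall>x\<in>V. (\<forall>i\<in>I. a i x \<le> 0) \<longrightarrow> g x \<le> 0")
    case True
    have "\<exists>w. (\<forall>i\<in>I. 0 \<le> w i) \<and> (\<forall>x\<in>V. g x = (\<Sum>i\<in>I. w i * a i x))"
      using insert.prems True by (intro insert.IH) auto
    then obtain w where w: "\<forall>i\<in>I. 0 \<le> w i" "\<forall>x\<in>V. g x = (\<Sum>i\<in>I. w i * a i x)"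
      by blast
    have "(\<Sum>i\<in>I. (w(k := 0)) i * a i x) = (\<Sum>i\<in>I. w i * a i x)" for x
      using insert.hyps by (intro sum.cong) auto
    then have "\<forall>x\<in>V. g x = (\<Sum>i\<in>insert k I. (w(k := 0)) i * a i x)"
      using w insert.hyps by simp
    moreover have "\<forall>i\<in>insert k I. 0 \<le> (w(k := 0)) i"
      using w by simp
    ultimately show ?thesis by blast
  next
    case False
    then obtain x0 where x0: "x0 \<in> V" "\<And>i. i \<in> I \<Longrightarrow> a i x0 \<le> 0" "g x0 > 0"
      by force
    have s: "a k x0 > 0"
      using insert.prems(3)[OF x0(1)] x0 by force
    (* a' and g' are the values of a and g at the projection of x along x0 into the kernel of a k. *)
    define a' where "a' i x = a i x - a k x / a k x0 * a i x0" for i x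
    define g' where "g' x = g x - a k x / a k x0 * g x0" for x
    have "\<exists>w. (\<forall>i\<in>I. 0 \<le> w i) \<and> (\<forall>x\<in>V. g' x = (\<Sum>i\<in>I. w i * a' i x))"
    proof (rule insert.IH)
      show "a' i (comb x t y) = a' i x + t * a' i y" if "i \<in> I" "x \<in> V" "y \<in> V" for i x t y
        unfolding a'_def using insert.prems(1)[of i x y t] insert.prems(1)[of k x y t] that s
        by (simp add: field_simps)
      show "g' (comb x t y) = g' x + t * g' y" if "x \<in> V" "y \<in> V" for x t y
        unfolding g'_def using insert.prems(2)[of x y t] insert.prems(1)[of k x y t] that s
        by (simp add: field_simps)
      show "g' x \<le> 0" if x: "x \<in> V" and le: "\<And>i. i \<in> I \<Longrightarrow> a' i x \<le> 0" for x
      proof -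
        define y where "y = comb x (- (a k x / a k x0)) x0"
        have y: "y \<in> V"
          unfolding y_def by (rule closed[OF x x0(1)])
        have ay: "a i y = a i x - a k x / a k x0 * a i x0" if "i \<in> insert k I" for i
          unfolding y_def using insert.prems(1)[OF that x x0(1)] by simp
        have "a i y \<le> 0" if "i \<in> insert k I" for i
          using ay[OF that] le[of i] that s unfolding a'_def by auto
        then have "g y \<le> 0"
          using insert.prems(3)[OF y] by blast
        then show "g' x \<le> 0"
          unfolding g'_def y_def using insert.prems(2)[OF x x0(1)] by simp
      qed
    qed
    then obtain w where w: "\<forall>i\<in>I. 0 \<le> w i" "\<forall>x\<in>V. g' x = (\<Sum>i\<in>I. w i * a' i x)"
      by blast
    define c where "c = (g x0 - (\<Sum>i\<in>I. w i * a i x0)) / a k x0"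
    have "(\<Sum>i\<in>I. w i * a i x0) \<le> 0"
      using w x0 by (intro sum_nonpos mult_nonneg_nonpos) auto
    then have c: "0 \<le> c"
      unfolding c_def using x0 s by simp
    have g_eq: "g x = c * a k x + (\<Sum>i\<in>I. w i * a i x)" if "x \<in> V" for x
    proof -
      have "(\<Sum>i\<in>I. w i * a' i x) = (\<Sum>i\<in>I. w i * a i x) - a k x / a k x0 * (\<Sum>i\<in>I. w i * a i x0)"
        unfolding a'_def by (simp add: algebra_simps sum_subtractf sum_distrib_left)
      then show ?thesis
        using w(2) that unfolding g'_def c_def by (simp add: algebra_simps diff_divide_distrib)
    qed
    have "(\<Sum>i\<in>I. (w(k := c)) i * a i x) = (\<Sum>i\<in>I. w i * a i x)" for x
      using insert.hyps by (intro sum.cong) auto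
    then have "\<forall>x\<in>V. g x = (\<Sum>i\<in>insert k I. (w(k := c)) i * a i x)"
      using g_eq insert.hyps by simp
    moreover have "\<forall>i\<in>insert k I. 0 \<le> (w(k := c)) i"
      using w c by simp
    ultimately show ?thesis by blast
  qed
qed

text \<open>
  Homogenise the inequalities \<open>a x \<le> b\<close> to \<open>a x \<le> s b\<close> with an additional coordinate \<open>s\<close>: a solution
  with \<open>s > 0\<close> could be scaled to a solution of the original system, so the homogeneous system
  implies \<open>s \<le> 0\<close>. The Farkas multipliers of this implication, read at \<open>s = 1\<close>, form the certificate.
\<close>

lemma infeasible_system_certificate:
  fixes a :: "'i \<Rightarrow> real vec" and b :: "'i \<Rightarrow> real"
  assumes I: "finite I" and a: "\<And>i. i \<in> I \<Longrightarrow> a i \<in> carrier_vec n"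
    and infeasible: "\<And>x. x \<in> carrier_vec n \<Longrightarrow> \<exists>i\<in>I. b i < a i \<bullet> x"
  shows "\<exists>w. (\<forall>i\<in>I. 0 \<le> w i) \<and> (\<forall>x\<in>carrier_vec n. (\<Sum>i\<in>I. w i * (a i \<bullet> x - b i)) = 1)"
proof -
  define V where "V = (carrier_vec n :: real vec set) \<times> (UNIV :: real set)"
  define comb where "comb p t q = (fst p + t \<cdot>\<^sub>v fst q, snd p + t * snd q)"
    for p q :: "real vec \<times> real" and t :: real
  define f where "f i p = a i \<bullet> fst p - snd p * b i" for i and p :: "real vec \<times> real"
  have "\<exists>w. (\<forall>i\<in>I. 0 \<le> w i) \<and> (\<forall>p\<in>V. snd p = (\<Sum>i\<in>I. w i * f i p))"
  proof (rule farkas_functionals[OF I, where comb = comb])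
    show "comb p t q \<in> V" if "p \<in> V" "q \<in> V" for p t q
      using that by (auto simp: V_def comb_def)
    show "f i (comb p t q) = f i p + t * f i q" if "i \<in> I" "p \<in> V" "q \<in> V" for i p t q
      using that a[OF that(1)]
      by (auto simp: V_def comb_def f_def scalar_prod_add_distrib[of _ n] algebra_simps)
    show "snd (comb p t q) = snd p + t * snd q" for p t q
      by (simp add: comb_def)
    show "snd p \<le> 0" if p: "p \<in> V" and le: "\<And>i. i \<in> I \<Longrightarrow> f i p \<le> 0" for p
    proof (rule ccontr)
      assume "\<not> snd p \<le> 0"
      then have s: "snd p > 0" by simp
      obtain i where i: "i \<in> I" "b i < a i \<bullet> (inverse (snd p) \<cdot>\<^sub>v fst p)"
        using infeasible[of "inverse (snd p) \<cdot>\<^sub>v fst p"] p by (auto simp: V_def)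
      then have "b i < (a i \<bullet> fst p) / snd p"
        using p a[OF i(1)] by (auto simp: V_def field_simps)
      then show False
        using le[OF i(1)] s by (simp add: f_def field_simps)
    qed
  qed
  then obtain w where w: "\<forall>i\<in>I. 0 \<le> w i" "\<forall>p\<in>V. snd p = (\<Sum>i\<in>I. w i * f i p)"
    by blast
  have "(\<Sum>i\<in>I. w i * (a i \<bullet> x - b i)) = 1" if "x \<in> carrier_vec n" for x
    using w(2)[rule_format, of "(x, 1)"] that by (simp add: V_def f_def)
  with w(1) show ?thesis by blast
qed

text \<open>
  If all inequalities were violated by at most \<open>e\<close>, their combination with the certificate's weights,
  which is constantly \<open>1\<close>, would be at most \<open>e\<close> times the total weight.
\<close>

lemma infeasible_system_stable:
  fixes a :: "'i \<Rightarrow> real vec" and b :: "'i \<Rightarrow> real"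
  assumes I: "finite I" and a: "\<And>i. i \<in> I \<Longrightarrow> a i \<in> carrier_vec n"
    and infeasible: "\<And>x. x \<in> carrier_vec n \<Longrightarrow> \<exists>i\<in>I. b i < a i \<bullet> x"
  shows "\<exists>e>0. \<forall>x\<in>carrier_vec n. \<exists>i\<in>I. b i + e < a i \<bullet> x"
proof -
  obtain w where w: "\<forall>i\<in>I. 0 \<le> w i"
    "\<forall>x\<in>carrier_vec n. (\<Sum>i\<in>I. w i * (a i \<bullet> x - b i)) = 1"
    using infeasible_system_certificate[OF assms] by blast
  define e where "e = 1 / (1 + (\<Sum>i\<in>I. w i))"
  have W: "(\<Sum>i\<in>I. w i) \<ge> 0"
    using w by (simp add: sum_nonneg)
  have e: "e > 0"
    unfolding e_def using W by simp
  have "\<exists>i\<in>I. b i + e < a i \<bullet> x" if x: "x \<in> carrier_vec n" for x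
  proof (rule ccontr)
    assume "\<not> ?thesis"
    then have "(\<Sum>i\<in>I. w i * (a i \<bullet> x - b i)) \<le> (\<Sum>i\<in>I. w i * e)"
      using w by (intro sum_mono mult_left_mono) (auto simp: not_less algebra_simps)
    also have "\<dots> = (\<Sum>i\<in>I. w i) * e"
      by (simp add: sum_distrib_right)
    also have "\<dots> < 1"
      unfolding e_def using W by (simp add: field_simps)
    finally show False using w x by simp
  qed
  with e show ?thesis by blast
qed

section \<open>Linear programs over the nonnegative orthant\<close>

lemma nonneg_vecs_iff: "x \<in> nonneg_vecs n \<longleftrightarrow> x \<in> carrier_vec n \<and> (\<forall>i<n. 0 \<le> x $ i)"
  unfolding nonneg_vecs_def less_eq_vec_def by fastforce
lemma nonpos_vecs_iff: "x \<in> nonpos_vecs n \<longleftrightarrow> x \<in> carrier_vec n \<and> (\<forall>i<n. x $ i \<le> 0)"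
  unfolding nonpos_vecs_def less_eq_vec_def by fastforce
lemma nonneg_vecsD:
  assumes "x \<in> nonneg_vecs n"
  shows "x \<in> carrier_vec n" and "\<And>i. i < n \<Longrightarrow> 0 \<le> x $ i"
  using assms by (simp_all add: nonneg_vecs_iff)

lemma nonpos_vecsD:
  assumes "x \<in> nonpos_vecs n"
  shows "x \<in> carrier_vec n" and "\<And>i. i < n \<Longrightarrow> x $ i \<le> 0"
  using assms by (simp_all add: nonpos_vecs_iff)

lemma less_eq_vecD:
  fixes x y :: "real vec"
  assumes "x \<le> y" "y \<in> carrier_vec n"
  shows "x \<in> carrier_vec n" and "\<And>i. i < n \<Longrightarrow> x $ i \<le> y $ i"
  using assms unfolding less_eq_vec_def by fastforce+

lemma less_eq_vecI:
  fixes x y :: "real vec"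
  assumes "x \<in> carrier_vec n" "y \<in> carrier_vec n" "\<And>i. i < n \<Longrightarrow> x $ i \<le> y $ i"
  shows "x \<le> y"
  using assms unfolding less_eq_vec_def by simp

lemma scalar_prod_mono_nonneg:
  fixes x y z :: "real vec"
  assumes "x \<le> y" "y \<in> carrier_vec n" "z \<in> nonneg_vecs n"
  shows "x \<bullet> z \<le> y \<bullet> z"
proof -
  have "dim_vec z = n" using nonneg_vecsD(1)[OF assms(3)] by simp
  then show ?thesis
    unfolding scalar_prod_def using less_eq_vecD(2)[OF assms(1,2)] nonneg_vecsD(2)[OF assms(3)]
    by (auto intro!: sum_mono mult_right_mono)
qed

lemma scalar_prod_mono_nonpos:
  fixes x y z :: "real vec"
  assumes "x \<le> y" "y \<in> carrier_vec n" "z \<in> nonpos_vecs n"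
  shows "y \<bullet> z \<le> x \<bullet> z"
proof -
  have "dim_vec z = n" using nonpos_vecsD(1)[OF assms(3)] by simp
  then show ?thesis
    unfolding scalar_prod_def using less_eq_vecD(2)[OF assms(1,2)] nonpos_vecsD(2)[OF assms(3)]
    by (auto intro!: sum_mono mult_right_mono_neg)
qed

text \<open>
  Strong duality in the direction in which a bound on the primal values yields a dual solution. If
  the dual system \<open>A\<^sup>T v \<le> c\<close>, \<open>\<delta> \<le> \<beta> v\<close> has no solution, its certificate consists of
  \<open>x \<ge> 0\<close> and \<open>t \<ge> 0\<close> with \<open>A x = t \<beta>\<close> and \<open>c x < t \<delta>\<close>. For \<open>t > 0\<close> the point \<open>x / t\<close> breaks the
  bound; for \<open>t = 0\<close> the vector \<open>x\<close> is a direction of unbounded decrease, and starting from the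
  feasible point \<open>x0\<close> it leads below the bound as well.
\<close>

lemma dual_certificate:
  fixes A :: "real mat"
  assumes A: "A \<in> carrier_mat m n" and \<beta>: "\<beta> \<in> carrier_vec m" and c: "c \<in> carrier_vec n"
    and x0: "x0 \<in> nonneg_vecs n" "A *\<^sub>v x0 = \<beta>"
    and bound: "\<And>x. x \<in> nonneg_vecs n \<Longrightarrow> A *\<^sub>v x = \<beta> \<Longrightarrow> \<delta> \<le> c \<bullet> x"
  shows "\<exists>v\<in>carrier_vec m. transpose_mat A *\<^sub>v v \<le> c \<and> \<delta> \<le> \<beta> \<bullet> v"
proof (rule ccontr)
  assume no_dual: "\<not> ?thesis"
  (* Index n carries the inequality on the dual objective, the indices below n the dual constraints. *)
  define a where "a j = (if j < n then col A j else - \<beta>)" for j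
  define b where "b j = (if j < n then c $ j else - \<delta>)" for j
  have "\<exists>w. (\<forall>j\<in>{..n}. 0 \<le> w j) \<and> (\<forall>v\<in>carrier_vec m. (\<Sum>j\<le>n. w j * (a j \<bullet> v - b j)) = 1)"
  proof (rule infeasible_system_certificate)
    show "a j \<in> carrier_vec m" for j
      using A \<beta> by (auto simp: a_def)
    fix v :: "real vec" assume v: "v \<in> carrier_vec m"
    then consider "\<not> transpose_mat A *\<^sub>v v \<le> c" | "\<beta> \<bullet> v < \<delta>"
      using no_dual by force
    then show "\<exists>j\<in>{..n}. b j < a j \<bullet> v"
    proof cases
      case 1
      then obtain j where "j < n" "c $ j < col A j \<bullet> v"
        using A c v by (force simp: less_eq_vec_def not_le)
      then show ?thesis by (intro bexI[of _ j]) (auto simp: a_def b_def)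
    next
      case 2
      then show ?thesis
        using v \<beta> by (intro bexI[of _ n]) (auto simp: a_def b_def)
    qed
  qed simp
  then obtain w where w: "\<And>j. j \<le> n \<Longrightarrow> 0 \<le> w j"
    "\<And>v. v \<in> carrier_vec m \<Longrightarrow> (\<Sum>j\<le>n. w j * (a j \<bullet> v - b j)) = 1"
    by auto
  define x where "x = vec n w"
  define t where "t = w n"
  have x: "x \<in> nonneg_vecs n" and t: "t \<ge> 0"
    using w(1) by (auto simp: x_def t_def nonneg_vecs_iff)
  have xc: "x \<in> carrier_vec n" by (simp add: x_def)
  have identity: "(A *\<^sub>v x) \<bullet> v - c \<bullet> x + t * (\<delta> - \<beta> \<bullet> v) = 1" if v: "v \<in> carrier_vec m" for v
  proof -
    have "(A *\<^sub>v x) \<bullet> v = (transpose_mat A *\<^sub>v v) \<bullet> x"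
      using transpose_vec_mult_scalar[OF A xc v] comm_scalar_prod[of "A *\<^sub>v x" m v] A xc v by simp
    also have "\<dots> = (\<Sum>j<n. w j * (col A j \<bullet> v))"
      using A by (simp add: scalar_prod_def x_def lessThan_atLeast0 mult.commute)
    finally have "(\<Sum>j<n. w j * (a j \<bullet> v - b j)) = (A *\<^sub>v x) \<bullet> v - c \<bullet> x"
      by (simp add: a_def b_def scalar_prod_def x_def lessThan_atLeast0 sum_subtractf algebra_simps)
    moreover have "(\<Sum>j\<le>n. w j * (a j \<bullet> v - b j)) = (\<Sum>j<n. w j * (a j \<bullet> v - b j)) + t * (\<delta> - \<beta> \<bullet> v)"
      using v \<beta> by (simp add: lessThan_Suc_atMost[symmetric] a_def b_def t_def)
    ultimately show ?thesis using w(2)[OF v] by simp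
  qed
  have objective: "t * \<delta> - c \<bullet> x = 1"
    using identity[of "0\<^sub>v m"] A \<beta> xc by simp
  have Ax: "A *\<^sub>v x = t \<cdot>\<^sub>v \<beta>"
  proof (rule eq_vecI)
    fix i assume "i < dim_vec (t \<cdot>\<^sub>v \<beta>)"
    then have i: "i < m" using \<beta> by simp
    have "(A *\<^sub>v x) \<bullet> unit_vec m i = t * (\<beta> \<bullet> unit_vec m i)"
      using identity[of "unit_vec m i"] objective by (simp add: algebra_simps)
    then show "(A *\<^sub>v x) $ i = (t \<cdot>\<^sub>v \<beta>) $ i"
      using i A \<beta> xc by simp
  qed (use A \<beta> in auto)
  show False
  proof (cases "t = 0")
    case True
    (* Each unit of x lowers the cost by 1, so s units take x0 below \<delta>. *)
    define s where "s = \<bar>c \<bullet> x0\<bar> + \<bar>\<delta>\<bar> + 1"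
    note x0c = nonneg_vecsD(1)[OF x0(1)]
    have "0 \<le> s" by (simp add: s_def)
    then have "x0 + s \<cdot>\<^sub>v x \<in> nonneg_vecs n"
      using xc x0c nonneg_vecsD(2)[OF x] nonneg_vecsD(2)[OF x0(1)] by (simp add: nonneg_vecs_iff)
    moreover have "A *\<^sub>v (x0 + s \<cdot>\<^sub>v x) = \<beta>"
      using xc x0c x0 Ax \<beta> True
      by (auto simp: mult_add_distrib_mat_vec[OF A] mult_mat_vec[OF A] intro!: eq_vecI)
    ultimately have "\<delta> \<le> c \<bullet> (x0 + s \<cdot>\<^sub>v x)" by (rule bound)
    also have "\<dots> = c \<bullet> x0 + s * (c \<bullet> x)"
      using c xc x0c by (simp add: scalar_prod_add_distrib[of _ n])
    also have "\<dots> = c \<bullet> x0 - s" using objective True by simp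
    finally show False by (simp add: s_def)
  next
    case False
    with t have t: "t > 0" by simp
    have "inverse t \<cdot>\<^sub>v x \<in> nonneg_vecs n"
      using xc nonneg_vecsD(2)[OF x] t by (simp add: nonneg_vecs_iff)
    moreover have "A *\<^sub>v (inverse t \<cdot>\<^sub>v x) = \<beta>"
      using A xc Ax \<beta> t by (auto simp: mult_mat_vec[OF A] smult_smult_assoc)
    ultimately have "\<delta> \<le> c \<bullet> (inverse t \<cdot>\<^sub>v x)" by (rule bound)
    also have "\<dots> = (c \<bullet> x) / t"
      using c xc by (simp add: field_simps)
    finally show False using objective t by (simp add: field_simps)
  qed
qed

lemma weak_duality:
  fixes A C :: "real mat"
  assumes A: "A \<in> carrier_mat m n" and C: "C \<in> carrier_mat l n"
    and \<eta>: "\<eta> \<in> carrier_vec l" and c: "c \<in> carrier_vec n"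
    and u: "u \<in> nonpos_vecs l" and v: "v \<in> carrier_vec m"
    and dual: "transpose_mat C *\<^sub>v u + transpose_mat A *\<^sub>v v \<le> c"
    and x: "x \<in> nonneg_vecs n" "C *\<^sub>v x \<le> \<eta>" "A *\<^sub>v x = \<beta>"
  shows "\<eta> \<bullet> u + \<beta> \<bullet> v \<le> c \<bullet> x"
proof -
  note xc = nonneg_vecsD(1)[OF x(1)] and uc = nonpos_vecsD(1)[OF u]
  have "\<eta> \<bullet> u \<le> (C *\<^sub>v x) \<bullet> u"
    by (rule scalar_prod_mono_nonpos[OF x(2) \<eta> u])
  also have "\<dots> = (transpose_mat C *\<^sub>v u) \<bullet> x"
    using transpose_vec_mult_scalar[OF C xc uc] comm_scalar_prod[of "C *\<^sub>v x" l u] C xc uc by simp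
  finally have "\<eta> \<bullet> u \<le> (transpose_mat C *\<^sub>v u) \<bullet> x" .
  moreover have "\<beta> \<bullet> v = (transpose_mat A *\<^sub>v v) \<bullet> x"
    using transpose_vec_mult_scalar[OF A xc v] comm_scalar_prod[of "A *\<^sub>v x" m v] A xc v x(3) by auto
  ultimately have "\<eta> \<bullet> u + \<beta> \<bullet> v \<le> (transpose_mat C *\<^sub>v u + transpose_mat A *\<^sub>v v) \<bullet> x"
    using A C uc v xc by (simp add: add_scalar_prod_distrib[of _ n])
  also have "\<dots> \<le> c \<bullet> x"
    by (rule scalar_prod_mono_nonneg[OF dual c x(1)])
  finally show ?thesis .
qed

text \<open>
  The hypothesis says that the system of all constraints together with \<open>c x \<le> \<delta>\<close> is infeasible, so
  stability of infeasibility applies. It also covers an infeasible linear program: relaxing its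
  constraints by \<open>e\<close> admits only points of cost above \<open>\<delta> + e\<close>.
\<close>

lemma lp_strict_bound_stable:
  fixes A C :: "real mat"
  assumes A: "A \<in> carrier_mat m n" and C: "C \<in> carrier_mat l n"
    and \<eta>: "\<eta> \<in> carrier_vec l" and \<beta>: "\<beta> \<in> carrier_vec m" and c: "c \<in> carrier_vec n"
    and infeasible: "\<And>x. x \<in> nonneg_vecs n \<Longrightarrow> A *\<^sub>v x = \<beta> \<Longrightarrow> C *\<^sub>v x \<le> \<eta> \<Longrightarrow> \<delta> < c \<bullet> x"
  shows "\<exists>e>0. \<forall>x\<in>nonneg_vecs n. A *\<^sub>v x = \<beta> \<longrightarrow> (\<forall>k<l. (C *\<^sub>v x) $ k \<le> \<eta> $ k + e) \<longrightarrow> \<delta> + e < c \<bullet> x"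
proof -
  (* Each constraint a x \<le> b is its own index (a, b); an equation contributes two inequalities. *)
  define I where "I = (\<lambda>j. (- unit_vec n j, 0)) ` {..<n} \<union>
    (\<lambda>i. (row A i, \<beta> $ i)) ` {..<m} \<union> (\<lambda>i. (- row A i, - \<beta> $ i)) ` {..<m} \<union>
    (\<lambda>k. (row C k, \<eta> $ k)) ` {..<l} \<union> {(c, \<delta>)}"
  have "\<exists>e>0. \<forall>x\<in>carrier_vec n. \<exists>p\<in>I. snd p + e < fst p \<bullet> x"
  proof (rule infeasible_system_stable)
    show "finite I" by (simp add: I_def)
    show "fst p \<in> carrier_vec n" if "p \<in> I" for p
      using that A C c by (auto simp: I_def)
    fix x :: "real vec" assume x: "x \<in> carrier_vec n"
    show "\<exists>p\<in>I. snd p < fst p \<bullet> x"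
    proof (rule ccontr)
      assume "\<not> ?thesis"
      then have le: "\<And>p. p \<in> I \<Longrightarrow> fst p \<bullet> x \<le> snd p" by force
      have "0 \<le> x $ j" if "j < n" for j
        using le[of "(- unit_vec n j, 0)"] that x by (auto simp: I_def)
      then have "x \<in> nonneg_vecs n"
        using x by (simp add: nonneg_vecs_iff)
      moreover have "row A i \<bullet> x = \<beta> $ i" if "i < m" for i
        using le[of "(row A i, \<beta> $ i)"] le[of "(- row A i, - \<beta> $ i)"] that x A by (auto simp: I_def)
      then have "A *\<^sub>v x = \<beta>"
        using A \<beta> by (intro eq_vecI) auto
      moreover have "row C k \<bullet> x \<le> \<eta> $ k" if "k < l" for k
        using le[of "(row C k, \<eta> $ k)"] that by (auto simp: I_def)
      then have "C *\<^sub>v x \<le> \<eta>"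
        using C \<eta> by (auto simp: less_eq_vec_def)
      ultimately have "\<delta> < c \<bullet> x" by (rule infeasible)
      then show False using le[of "(c, \<delta>)"] by (simp add: I_def)
    qed
  qed
  then obtain e where e: "e > 0" and viol: "\<And>x. x \<in> carrier_vec n \<Longrightarrow> \<exists>p\<in>I. snd p + e < fst p \<bullet> x"
    by blast
  have "\<delta> + e < c \<bullet> x"
    if x: "x \<in> nonneg_vecs n" "A *\<^sub>v x = \<beta>" "\<forall>k<l. (C *\<^sub>v x) $ k \<le> \<eta> $ k + e" for x
  proof -
    note xc = nonneg_vecsD(1)[OF x(1)]
    have "row A i \<bullet> x = \<beta> $ i" if "i < m" for i
      using A that index_mult_mat_vec[of i A x] by (simp add: x(2))
    moreover have "row C k \<bullet> x \<le> \<eta> $ k + e" if "k < l" for k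
      using C x(3)[rule_format, OF that] that by simp
    moreover have "- x $ j \<le> e" if "j < n" for j
      using nonneg_vecsD(2)[OF x(1) that] e by simp
    ultimately have "fst p \<bullet> x \<le> snd p + e" if "p \<in> I" "p \<noteq> (c, \<delta>)" for p
      using that e A xc by (auto simp: I_def)
    then show ?thesis
      using viol[OF xc] by (metis fst_conv snd_conv not_le)
  qed
  with e show ?thesis by blast
qed

section \<open>Norm estimates and finiteness of the set of integer parts\<close>

lemma component_le_euclid_norm:
  assumes "d \<in> carrier_vec n" "i < n"
  shows "\<bar>d $ i\<bar> \<le> euclid_norm d"
proof -
  have "(d $ i)\<^sup>2 \<le> (\<Sum>j = 0..<n. (d $ j)\<^sup>2)"
    using assms by (intro member_le_sum) auto
  also have "\<dots> = d \<bullet> d"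
    using assms by (simp add: scalar_prod_def power2_eq_square)
  finally show ?thesis
    unfolding euclid_norm_def by (simp add: real_le_rsqrt)
qed

lemma euclid_norm_smult: "euclid_norm (t \<cdot>\<^sub>v d) = \<bar>t\<bar> * euclid_norm d"
  by (simp add: euclid_norm_def real_sqrt_mult flip: mult.assoc)

lemma euclid_norm_nonneg: "0 \<le> euclid_norm d"
  by (simp add: euclid_norm_def scalar_prod_def sum_nonneg)

lemma scalar_prod_le_euclid_norm:
  assumes q: "q \<in> carrier_vec n" and d: "d \<in> carrier_vec n"
  shows "q \<bullet> d \<le> (\<Sum>i<n. \<bar>q $ i\<bar>) * euclid_norm d"
proof -
  have "q \<bullet> d = (\<Sum>i<n. q $ i * d $ i)"
    using d by (simp add: scalar_prod_def lessThan_atLeast0)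
  also have "\<dots> \<le> (\<Sum>i<n. \<bar>q $ i\<bar> * euclid_norm d)"
  proof (rule sum_mono)
    fix i assume "i \<in> {..<n}"
    then have "\<bar>q $ i\<bar> * \<bar>d $ i\<bar> \<le> \<bar>q $ i\<bar> * euclid_norm d"
      using component_le_euclid_norm[OF d] by (intro mult_left_mono) auto
    then show "q $ i * d $ i \<le> \<bar>q $ i\<bar> * euclid_norm d"
      using abs_ge_self[of "q $ i * d $ i"] by (simp add: abs_mult)
  qed
  finally show ?thesis by (simp add: sum_distrib_right)
qed

lemma finite_vecs_with_entries:
  assumes "finite S"
  shows "finite {x \<in> carrier_vec n. set\<^sub>v x \<subseteq> S}"
proof (rule finite_subset)
  show "{x \<in> carrier_vec n. set\<^sub>v x \<subseteq> S} \<subseteq> vec_of_list ` {xs. set xs \<subseteq> S \<and> length xs = n}"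
  proof
    fix x assume "x \<in> {x \<in> carrier_vec n. set\<^sub>v x \<subseteq> S}"
    then have "list_of_vec x \<in> {xs. set xs \<subseteq> S \<and> length xs = n}"
      by (auto simp: set_list_of_vec)
    then show "x \<in> vec_of_list ` {xs. set xs \<subseteq> S \<and> length xs = n}"
      using vec_list[of x] by (metis imageI)
  qed
  show "finite (vec_of_list ` {xs. set xs \<subseteq> S \<and> length xs = n})"
    using finite_lists_length_eq[OF assms] by simp
qed

lemma finite_int_parts:
  assumes "bounded_X_MO P"
  shows "finite (int_parts P)"
proof -
  obtain B where B: "\<And>x\<^sub>I x\<^sub>C. (x\<^sub>I, x\<^sub>C) \<in> X_MO P \<Longrightarrow> euclid_norm (x\<^sub>I @\<^sub>v x\<^sub>C) \<le> B"
    using assms by (auto simp: bounded_X_MO_def)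
  define S where "S = (of_int ` {0..\<lfloor>B\<rfloor>} :: real set)"
  have "int_parts P \<subseteq> {x \<in> carrier_vec (num_int P). set\<^sub>v x \<subseteq> S}"
  proof
    fix x\<^sub>I assume "x\<^sub>I \<in> int_parts P"
    then obtain x\<^sub>C where X: "(x\<^sub>I, x\<^sub>C) \<in> X_MO P"
      by (auto simp: int_parts_def int_parts_at_def feas_set_def)
    then have nonneg: "x\<^sub>I \<in> nonneg_vecs (num_int P)" and int: "set\<^sub>v x\<^sub>I \<subseteq> \<int>"
      and cont: "x\<^sub>C \<in> carrier_vec (num_cont P)"
      by (auto simp: X_MO_def nonneg_int_vecs_def dest: nonneg_vecsD)
    have entry: "x\<^sub>I $ i \<in> S" if i: "i < num_int P" for i
    proof -
      have "x\<^sub>I $ i \<in> set\<^sub>v x\<^sub>I"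
        using i nonneg_vecsD(1)[OF nonneg] by (intro vec_setI) auto
      then obtain k where k: "x\<^sub>I $ i = of_int k"
        using int by (auto elim: Ints_cases)
      have "\<bar>(x\<^sub>I @\<^sub>v x\<^sub>C) $ i\<bar> \<le> euclid_norm (x\<^sub>I @\<^sub>v x\<^sub>C)"
        using i nonneg_vecsD(1)[OF nonneg] cont
        by (intro component_le_euclid_norm[of _ "num_int P + num_cont P"]) auto
      then have "x\<^sub>I $ i \<le> B"
        using B[OF X] i nonneg_vecsD(1)[OF nonneg] by auto
      then have "k \<in> {0..\<lfloor>B\<rfloor>}"
        using k nonneg_vecsD(2)[OF nonneg i] by (simp add: le_floor_iff)
      then show ?thesis unfolding S_def k by blast
    qed
    then have "set\<^sub>v x\<^sub>I \<subseteq> S"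
      using nonneg_vecsD(1)[OF nonneg] by (auto elim!: vec_setE)
    then show "x\<^sub>I \<in> {x \<in> carrier_vec (num_int P). set\<^sub>v x \<subseteq> S}"
      using nonneg_vecsD(1)[OF nonneg] by simp
  qed
  moreover have "finite S" by (simp add: S_def)
  ultimately show ?thesis
    using finite_vecs_with_entries finite_subset by blast
qed

section \<open>The linear program of a fixed integer part\<close>

definition lp_feas :: "mo_data \<Rightarrow> real vec \<Rightarrow> real vec \<Rightarrow> real vec set" where
  "lp_feas P \<eta> \<beta> = {x \<in> nonneg_vecs (num_cont P). C\<^sub>C P *\<^sub>v x \<le> \<eta> \<and> A\<^sub>C P *\<^sub>v x = \<beta>}"

lemma z_LP_eq: "z_LP P \<eta> \<beta> = (INF x \<in> lp_feas P \<eta> \<beta>. ereal (c0\<^sub>C P \<bullet> x))"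
  by (simp add: z_LP_def lp_feas_def)

abbreviation resid_rhs :: "mo_data \<Rightarrow> real vec \<Rightarrow> real vec \<Rightarrow> real vec" where
  "resid_rhs P \<zeta> x\<^sub>I \<equiv> \<zeta> - C\<^sub>I P *\<^sub>v x\<^sub>I"

abbreviation resid_eq_rhs :: "mo_data \<Rightarrow> real vec \<Rightarrow> real vec" where
  "resid_eq_rhs P x\<^sub>I \<equiv> eq_rhs P - A\<^sub>I P *\<^sub>v x\<^sub>I"

context
  fixes P :: mo_data
  assumes data: "rational_mo_data P"
begin

lemma data_carriers:
  shows "A\<^sub>I P \<in> carrier_mat (num_eqs P) (num_int P)"
    and "A\<^sub>C P \<in> carrier_mat (num_eqs P) (num_cont P)"
    and "C\<^sub>I P \<in> carrier_mat (num_restr P) (num_int P)"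
    and "C\<^sub>C P \<in> carrier_mat (num_restr P) (num_cont P)"
    and "c0\<^sub>I P \<in> carrier_vec (num_int P)"
    and "c0\<^sub>C P \<in> carrier_vec (num_cont P)"
    and "eq_rhs P \<in> carrier_vec (num_eqs P)"
proof -
  have "cost_mat P \<in> carrier_mat (num_restr P + 1) (num_vars P)"
    and rhs: "eq_rhs P \<in> carrier_vec (num_eqs P)"
    using data by (simp_all only: rational_mo_data_def)
  from this(1) have cols: "dim_col (cost_mat P) = num_vars P"
    by (rule carrier_matD(2))
  show "A\<^sub>I P \<in> carrier_mat (num_eqs P) (num_int P)"
    and "A\<^sub>C P \<in> carrier_mat (num_eqs P) (num_cont P)"
    and "C\<^sub>I P \<in> carrier_mat (num_restr P) (num_int P)"
    and "C\<^sub>C P \<in> carrier_mat (num_restr P) (num_cont P)"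
    by (simp_all add: cols A\<^sub>I_def A\<^sub>C_def C\<^sub>I_def C\<^sub>C_def int_cols_def cont_cols_def restr_mat_def)
  show "c0\<^sub>I P \<in> carrier_vec (num_int P)" and "c0\<^sub>C P \<in> carrier_vec (num_cont P)"
    by (rule carrier_vecI, simp add: cols c0\<^sub>I_def c0\<^sub>C_def int_cols_def cont_cols_def)+
  show "eq_rhs P \<in> carrier_vec (num_eqs P)" by (rule rhs)
qed

lemma resid_carriers:
  assumes "\<zeta> \<in> carrier_vec (num_restr P)"
  shows "resid_rhs P \<zeta> x\<^sub>I \<in> carrier_vec (num_restr P)"
    and "resid_eq_rhs P x\<^sub>I \<in> carrier_vec (num_eqs P)"
  using data_carriers by (auto intro!: carrier_vecI)

lemma restr_image_carrier: "C\<^sub>C P *\<^sub>v x \<in> carrier_vec (num_restr P)"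
  using data_carriers(4) by (auto intro!: carrier_vecI)

lemma feas_set_iff_lp_feas:
  assumes \<zeta>: "\<zeta> \<in> carrier_vec (num_restr P)"
  shows "(x\<^sub>I, x\<^sub>C) \<in> feas_set P \<zeta> \<longleftrightarrow>
    x\<^sub>I \<in> nonneg_int_vecs (num_int P) \<and> x\<^sub>C \<in> lp_feas P (resid_rhs P \<zeta> x\<^sub>I) (resid_eq_rhs P x\<^sub>I)"
proof -
  have shift_le: "C\<^sub>I P *\<^sub>v x\<^sub>I + C\<^sub>C P *\<^sub>v x\<^sub>C \<le> \<zeta> \<longleftrightarrow> C\<^sub>C P *\<^sub>v x\<^sub>C \<le> resid_rhs P \<zeta> x\<^sub>I"
    using data_carriers \<zeta> by (auto simp: less_eq_vec_def algebra_simps)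
  have shift_eq: "A\<^sub>I P *\<^sub>v x\<^sub>I + A\<^sub>C P *\<^sub>v x\<^sub>C = eq_rhs P \<longleftrightarrow> A\<^sub>C P *\<^sub>v x\<^sub>C = resid_eq_rhs P x\<^sub>I"
    using data_carriers by (auto simp: vec_eq_iff algebra_simps)
  show ?thesis
    by (auto simp: feas_set_def X_MO_def lp_feas_def shift_le shift_eq)
qed

lemma restr_value_le_obj:
  assumes "(x\<^sub>I, x\<^sub>C) \<in> feas_set P \<zeta>"
  shows "restr_value P \<zeta> \<le> ereal (obj P x\<^sub>I x\<^sub>C)"
  unfolding restr_value_def using assms by (auto intro!: INF_lower2)

lemma restr_value_antimono:
  assumes "\<zeta> \<le> \<zeta>'"
  shows "restr_value P \<zeta>' \<le> restr_value P \<zeta>"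
proof -
  have "feas_set P \<zeta> \<subseteq> feas_set P \<zeta>'"
    unfolding feas_set_def using order_trans[OF _ assms] by blast
  then show ?thesis
    unfolding restr_value_def by (rule INF_superset_mono) simp
qed

text \<open>
  Relaxing a single constraint cannot increase the value, which bounds the corresponding component
  of a subgradient.
\<close>

lemma subgradient_nonpos:
  assumes q: "local_subgradient (num_restr P) (restr_value P) \<zeta> q"
    and \<zeta>: "\<zeta> \<in> carrier_vec (num_restr P)" and z0: "restr_value P \<zeta> = ereal z0"
  shows "q \<in> nonpos_vecs (num_restr P)"
proof -
  obtain e where qc: "q \<in> carrier_vec (num_restr P)" and e: "e > 0"
    and sub: "\<And>\<zeta>'. \<zeta>' \<in> carrier_vec (num_restr P) \<Longrightarrow> euclid_norm (\<zeta>' - \<zeta>) \<le> e \<Longrightarrow>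
      restr_value P \<zeta>' \<ge> restr_value P \<zeta> + ereal (q \<bullet> (\<zeta>' - \<zeta>))"
    using q unfolding local_subgradient_def by blast
  have "q $ k \<le> 0" if k: "k < num_restr P" for k
  proof -
    define d where "d = e \<cdot>\<^sub>v unit_vec (num_restr P) k"
    have d: "d \<in> carrier_vec (num_restr P)" by (simp add: d_def)
    have diff: "\<zeta> + d - \<zeta> = d" using \<zeta> d by auto
    have "euclid_norm d \<le> e"
      using k e by (simp add: d_def euclid_norm_smult euclid_norm_def)
    then have "restr_value P (\<zeta> + d) \<ge> ereal (z0 + q \<bullet> d)"
      using sub[of "\<zeta> + d"] \<zeta> d z0 diff by simp
    moreover have "\<zeta> \<le> \<zeta> + d"
      using \<zeta> e by (auto simp: less_eq_vec_def d_def unit_vec_def)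
    then have "restr_value P (\<zeta> + d) \<le> ereal z0"
      using restr_value_antimono z0 by metis
    ultimately have "q \<bullet> d \<le> 0"
      by (metis add_le_cancel_left add.right_neutral ereal_less_eq(3) order_trans)
    then show ?thesis
      using e qc k by (simp add: d_def mult_le_0_iff)
  qed
  with qc show ?thesis by (simp add: nonpos_vecs_iff)
qed

lemma z_LP_at_optimal_int_part:
  assumes "x\<^sub>I \<in> opt_int_parts P \<zeta>" and "restr_value P \<zeta> = ereal z0"
  shows "z_LP P (resid_rhs P \<zeta> x\<^sub>I) (resid_eq_rhs P x\<^sub>I) = ereal (z0 - c0\<^sub>I P \<bullet> x\<^sub>I)"
  using assms unfolding opt_int_parts_def z_bar_def
  by (cases "z_LP P (resid_rhs P \<zeta> x\<^sub>I) (resid_eq_rhs P x\<^sub>I)") auto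

text \<open>Convexity of the linear programming value function, at the level of feasible points.\<close>

lemma lp_feas_convex:
  assumes x: "x \<in> lp_feas P \<eta> \<beta>" and y: "y \<in> lp_feas P \<eta>' \<beta>"
    and \<eta>: "\<eta> \<in> carrier_vec (num_restr P)" and \<eta>': "\<eta>' \<in> carrier_vec (num_restr P)" and t: "0 \<le> t" "t \<le> 1"
  shows "(1 - t) \<cdot>\<^sub>v x + t \<cdot>\<^sub>v y \<in> lp_feas P (\<eta> + t \<cdot>\<^sub>v (\<eta>' - \<eta>)) \<beta>"
proof -
  have nonneg: "x \<in> nonneg_vecs (num_cont P)" "y \<in> nonneg_vecs (num_cont P)"
    and le: "C\<^sub>C P *\<^sub>v x \<le> \<eta>" "C\<^sub>C P *\<^sub>v y \<le> \<eta>'" and eq: "A\<^sub>C P *\<^sub>v x = \<beta>" "A\<^sub>C P *\<^sub>v y = \<beta>"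
    using x y by (auto simp: lp_feas_def)
  note c = nonneg_vecsD(1)[OF nonneg(1)] nonneg_vecsD(1)[OF nonneg(2)]
  have lin: "M *\<^sub>v ((1 - t) \<cdot>\<^sub>v x + t \<cdot>\<^sub>v y) = (1 - t) \<cdot>\<^sub>v (M *\<^sub>v x) + t \<cdot>\<^sub>v (M *\<^sub>v y)"
    if M: "M \<in> carrier_mat k (num_cont P)" for M :: "real mat" and k
    using c by (simp add: mult_add_distrib_mat_vec[OF M] mult_mat_vec[OF M])
  have "(1 - t) \<cdot>\<^sub>v x + t \<cdot>\<^sub>v y \<in> nonneg_vecs (num_cont P)"
    using c t nonneg_vecsD(2)[OF nonneg(1)] nonneg_vecsD(2)[OF nonneg(2)]
    by (simp add: nonneg_vecs_iff)
  moreover have "C\<^sub>C P *\<^sub>v ((1 - t) \<cdot>\<^sub>v x + t \<cdot>\<^sub>v y) \<le> \<eta> + t \<cdot>\<^sub>v (\<eta>' - \<eta>)"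
  proof (rule less_eq_vecI[of _ "num_restr P"])
    show "C\<^sub>C P *\<^sub>v ((1 - t) \<cdot>\<^sub>v x + t \<cdot>\<^sub>v y) \<in> carrier_vec (num_restr P)"
      using data_carriers(4) c by simp
    show "\<eta> + t \<cdot>\<^sub>v (\<eta>' - \<eta>) \<in> carrier_vec (num_restr P)"
      using \<eta> \<eta>' by simp
    fix k assume k: "k < num_restr P"
    have "(1 - t) * (C\<^sub>C P *\<^sub>v x) $ k + t * (C\<^sub>C P *\<^sub>v y) $ k \<le> (1 - t) * \<eta> $ k + t * \<eta>' $ k"
      using t less_eq_vecD(2)[OF le(1) \<eta> k] less_eq_vecD(2)[OF le(2) \<eta>' k]
      by (intro add_mono mult_left_mono) auto
    moreover have "dim_row (C\<^sub>C P) = num_restr P" using data_carriers(4) by simp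
    ultimately show "(C\<^sub>C P *\<^sub>v ((1 - t) \<cdot>\<^sub>v x + t \<cdot>\<^sub>v y)) $ k \<le> (\<eta> + t \<cdot>\<^sub>v (\<eta>' - \<eta>)) $ k"
      unfolding lin[OF data_carriers(4)] using k \<eta> \<eta>' 
      by (simp add: algebra_simps del: index_mult_mat_vec)
  qed
  moreover have "A\<^sub>C P *\<^sub>v ((1 - t) \<cdot>\<^sub>v x + t \<cdot>\<^sub>v y) = \<beta>"
    unfolding lin[OF data_carriers(2)] eq by (rule eq_vecI) (auto simp: algebra_simps)
  ultimately show ?thesis by (simp add: lp_feas_def)
qed

section \<open>Local subgradients are optimal dual solutions\<close>

text \<open>
  The passage from local to global. A nearly optimal point \<open>x0\<close> for \<open>\<zeta>\<close> is moved a fraction \<open>t\<close> of the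
  way towards \<open>x1\<close>. The resulting point is feasible for a right-hand side so close to \<open>\<zeta>\<close> that the
  local inequality applies, and in that inequality everything but the suboptimality of \<open>x0\<close> scales
  with \<open>t\<close>. As \<open>t\<close> does not depend on \<open>x0\<close>, the suboptimality can tend to \<open>0\<close> with \<open>t\<close>
  fixed, and no optimal solution is required to exist.
\<close>

lemma local_subgradient_supports_lp:
  assumes q: "local_subgradient (num_restr P) (restr_value P) \<zeta> q"
    and \<zeta>: "\<zeta> \<in> carrier_vec (num_restr P)" and z0: "restr_value P \<zeta> = ereal z0"
    and opt: "x\<^sub>I \<in> opt_int_parts P \<zeta>"
    and x1: "x1 \<in> nonneg_vecs (num_cont P)" "A\<^sub>C P *\<^sub>v x1 = resid_eq_rhs P x\<^sub>I"
  shows "z0 - c0\<^sub>I P \<bullet> x\<^sub>I + q \<bullet> (C\<^sub>C P *\<^sub>v x1 - resid_rhs P \<zeta> x\<^sub>I) \<le> c0\<^sub>C P \<bullet> x1"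
proof -
  obtain e where qc: "q \<in> carrier_vec (num_restr P)" and e: "e > 0"
    and sub: "\<And>\<zeta>'. \<zeta>' \<in> carrier_vec (num_restr P) \<Longrightarrow> euclid_norm (\<zeta>' - \<zeta>) \<le> e \<Longrightarrow>
      restr_value P \<zeta>' \<ge> restr_value P \<zeta> + ereal (q \<bullet> (\<zeta>' - \<zeta>))"
    using q unfolding local_subgradient_def by blast
  define \<eta> where "\<eta> = resid_rhs P \<zeta> x\<^sub>I"
  define \<beta> where "\<beta> = resid_eq_rhs P x\<^sub>I"
  define w where "w = z0 - c0\<^sub>I P \<bullet> x\<^sub>I"
  define d where "d = C\<^sub>C P *\<^sub>v x1 - \<eta>"
  (* The 1 in the denominator avoids a division by 0 when d = 0. *)
  define t where "t = min 1 (e / (1 + euclid_norm d))"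
  have \<eta>: "\<eta> \<in> carrier_vec (num_restr P)"
    unfolding \<eta>_def by (rule resid_carriers(1)[OF \<zeta>])
  have d: "d \<in> carrier_vec (num_restr P)"
    unfolding d_def using restr_image_carrier \<eta> by (rule minus_carrier_vec)
  have t: "0 < t" "t \<le> 1"
    using e euclid_norm_nonneg[of d] by (simp_all add: t_def)
  have "t * euclid_norm d \<le> e / (1 + euclid_norm d) * euclid_norm d"
    using euclid_norm_nonneg[of d] by (intro mult_right_mono) (simp_all add: t_def)
  also have "\<dots> \<le> e"
    using e euclid_norm_nonneg[of d] by (simp add: field_simps)
  finally have small: "euclid_norm (t \<cdot>\<^sub>v d) \<le> e"
    using t by (simp add: euclid_norm_smult)
  have int: "x\<^sub>I \<in> nonneg_int_vecs (num_int P)"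
    using opt by (auto simp: opt_int_parts_def int_parts_at_def feas_set_def X_MO_def)
  have x1_feas: "x1 \<in> lp_feas P (C\<^sub>C P *\<^sub>v x1) \<beta>"
    using x1 by (simp add: lp_feas_def \<beta>_def)
  have "t * (w + q \<bullet> d - c0\<^sub>C P \<bullet> x1) \<le> 0 + \<kappa>" if \<kappa>: "\<kappa> > 0" for \<kappa>
  proof -
    have "z_LP P \<eta> \<beta> = ereal w"
      unfolding \<eta>_def \<beta>_def w_def by (rule z_LP_at_optimal_int_part[OF opt z0])
    then have "(INF x \<in> lp_feas P \<eta> \<beta>. ereal (c0\<^sub>C P \<bullet> x)) < ereal (w + \<kappa>)"
      using \<kappa> by (simp flip: z_LP_eq)
    then obtain x0 where x0: "x0 \<in> lp_feas P \<eta> \<beta>" and near: "c0\<^sub>C P \<bullet> x0 < w + \<kappa>"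
      by (auto simp: INF_less_iff)
    define x where "x = (1 - t) \<cdot>\<^sub>v x0 + t \<cdot>\<^sub>v x1"
    have "x \<in> lp_feas P (\<eta> + t \<cdot>\<^sub>v d) \<beta>"
      unfolding x_def d_def using t by (intro lp_feas_convex x0 x1_feas \<eta> restr_image_carrier) auto
    moreover have "\<eta> + t \<cdot>\<^sub>v d = resid_rhs P (\<zeta> + t \<cdot>\<^sub>v d) x\<^sub>I"
      using \<zeta> d data_carriers(3) by (auto simp: \<eta>_def)
    ultimately have "(x\<^sub>I, x) \<in> feas_set P (\<zeta> + t \<cdot>\<^sub>v d)"
      using feas_set_iff_lp_feas[of "\<zeta> + t \<cdot>\<^sub>v d"] \<zeta> d int by (simp add: \<beta>_def)
    then have "restr_value P (\<zeta> + t \<cdot>\<^sub>v d) \<le> ereal (obj P x\<^sub>I x)"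
      by (rule restr_value_le_obj)
    moreover have "\<zeta> + t \<cdot>\<^sub>v d - \<zeta> = t \<cdot>\<^sub>v d"
      using \<zeta> d by auto
    then have "ereal (z0 + q \<bullet> (t \<cdot>\<^sub>v d)) \<le> restr_value P (\<zeta> + t \<cdot>\<^sub>v d)"
      using sub[of "\<zeta> + t \<cdot>\<^sub>v d"] small \<zeta> d z0 by simp
    ultimately have "z0 + q \<bullet> (t \<cdot>\<^sub>v d) \<le> obj P x\<^sub>I x"
      by (metis ereal_less_eq(3) order_trans)
    moreover have "c0\<^sub>C P \<bullet> x = (1 - t) * (c0\<^sub>C P \<bullet> x0) + t * (c0\<^sub>C P \<bullet> x1)"
      using x0 x1 data_carriers(6) unfolding x_def lp_feas_def
      by (auto simp: scalar_prod_add_distrib[of _ "num_cont P"] dest!: nonneg_vecsD(1))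
    ultimately have "w + t * (q \<bullet> d) \<le> (1 - t) * (c0\<^sub>C P \<bullet> x0) + t * (c0\<^sub>C P \<bullet> x1)"
      using qc d by (simp add: obj_def w_def)
    also have "(1 - t) * (c0\<^sub>C P \<bullet> x0) \<le> (1 - t) * (w + \<kappa>)"
      using near t by (intro mult_left_mono) auto
    also have "(1 - t) * (w + \<kappa>) \<le> (1 - t) * w + \<kappa>"
      using t \<kappa> by (simp add: algebra_simps)
    finally show ?thesis by (simp add: algebra_simps)
  qed
  then have "t * (w + q \<bullet> d - c0\<^sub>C P \<bullet> x1) \<le> 0"
    by (rule field_le_epsilon)
  then show ?thesis
    using t by (simp add: mult_le_0_iff w_def d_def \<eta>_def)
qed

text \<open>
  With \<open>q\<close> moved into the objective, the supporting inequality bounds a linear function on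
  \<open>{x \<ge> 0. A\<^sub>C x = \<beta>}\<close>. The \<open>v\<close> certifying this bound completes \<open>q\<close> to a dual
  solution of value at least the optimum, and weak duality gives equality.
\<close>

lemma local_subgradient_in_dual_opt_proj:
  assumes q: "local_subgradient (num_restr P) (restr_value P) \<zeta> q"
    and \<zeta>: "\<zeta> \<in> carrier_vec (num_restr P)" and z0: "restr_value P \<zeta> = ereal z0"
    and opt: "x\<^sub>I \<in> opt_int_parts P \<zeta>"
  shows "q \<in> dual_opt_proj P (resid_rhs P \<zeta> x\<^sub>I) (resid_eq_rhs P x\<^sub>I)"
proof -
  define \<eta> where "\<eta> = resid_rhs P \<zeta> x\<^sub>I"
  define \<beta> where "\<beta> = resid_eq_rhs P x\<^sub>I"
  define w where "w = z0 - c0\<^sub>I P \<bullet> x\<^sub>I"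
  define c where "c = c0\<^sub>C P - transpose_mat (C\<^sub>C P) *\<^sub>v q"
  note nonpos = subgradient_nonpos[OF q \<zeta> z0]
  note qc = nonpos_vecsD(1)[OF nonpos]
  have \<eta>: "\<eta> \<in> carrier_vec (num_restr P)" and \<beta>: "\<beta> \<in> carrier_vec (num_eqs P)"
    unfolding \<eta>_def \<beta>_def by (rule resid_carriers[OF \<zeta>])+
  have CTq: "transpose_mat (C\<^sub>C P) *\<^sub>v q \<in> carrier_vec (num_cont P)"
    using data_carriers(4) by (auto intro!: carrier_vecI)
  have c: "c \<in> carrier_vec (num_cont P)"
    using data_carriers(6) CTq by (simp add: c_def)
  have z_LP: "z_LP P \<eta> \<beta> = ereal w"
    unfolding \<eta>_def \<beta>_def w_def by (rule z_LP_at_optimal_int_part[OF opt z0])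
  obtain x0 where x0: "x0 \<in> lp_feas P \<eta> \<beta>"
    using opt feas_set_iff_lp_feas[OF \<zeta>]
    by (auto simp: opt_int_parts_def int_parts_at_def \<eta>_def \<beta>_def)
  have "\<exists>v\<in>carrier_vec (num_eqs P). transpose_mat (A\<^sub>C P) *\<^sub>v v \<le> c \<and> w - q \<bullet> \<eta> \<le> \<beta> \<bullet> v"
  proof (rule dual_certificate[OF data_carriers(2) \<beta> c])
    show "x0 \<in> nonneg_vecs (num_cont P)" "A\<^sub>C P *\<^sub>v x0 = \<beta>"
      using x0 by (simp_all add: lp_feas_def)
    fix x assume x: "x \<in> nonneg_vecs (num_cont P)" "A\<^sub>C P *\<^sub>v x = \<beta>"
    note xc = nonneg_vecsD(1)[OF x(1)]
    have "w + q \<bullet> (C\<^sub>C P *\<^sub>v x - \<eta>) \<le> c0\<^sub>C P \<bullet> x"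
      using local_subgradient_supports_lp[OF q \<zeta> z0 opt x(1)] x(2)
      by (simp add: w_def \<eta>_def \<beta>_def)
    moreover have "q \<bullet> (C\<^sub>C P *\<^sub>v x - \<eta>) = q \<bullet> (C\<^sub>C P *\<^sub>v x) - q \<bullet> \<eta>"
      by (rule scalar_prod_minus_distrib[OF qc restr_image_carrier \<eta>])
    moreover have "(transpose_mat (C\<^sub>C P) *\<^sub>v q) \<bullet> x = q \<bullet> (C\<^sub>C P *\<^sub>v x)"
      by (rule transpose_vec_mult_scalar[OF data_carriers(4) xc qc])
    moreover have "c \<bullet> x = c0\<^sub>C P \<bullet> x - (transpose_mat (C\<^sub>C P) *\<^sub>v q) \<bullet> x"
      unfolding c_def by (rule minus_scalar_prod_distrib[OF data_carriers(6) CTq xc])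
    ultimately show "w - q \<bullet> \<eta> \<le> c \<bullet> x" by simp
  qed
  then obtain v where v: "v \<in> carrier_vec (num_eqs P)" "transpose_mat (A\<^sub>C P) *\<^sub>v v \<le> c"
    "w - q \<bullet> \<eta> \<le> \<beta> \<bullet> v"
    by blast
  have dual: "transpose_mat (C\<^sub>C P) *\<^sub>v q + transpose_mat (A\<^sub>C P) *\<^sub>v v \<le> c0\<^sub>C P"
  proof (rule less_eq_vecI[of _ "num_cont P"])
    show "transpose_mat (C\<^sub>C P) *\<^sub>v q + transpose_mat (A\<^sub>C P) *\<^sub>v v \<in> carrier_vec (num_cont P)"
      using CTq data_carriers(2) by (auto intro!: add_carrier_vec carrier_vecI)
    show "c0\<^sub>C P \<in> carrier_vec (num_cont P)" by (rule data_carriers)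
    fix j assume j: "j < num_cont P"
    show "(transpose_mat (C\<^sub>C P) *\<^sub>v q + transpose_mat (A\<^sub>C P) *\<^sub>v v) $ j \<le> c0\<^sub>C P $ j"
      using less_eq_vecD(2)[OF v(2) c j] j data_carriers(2,4,6)
      by (simp add: c_def)
  qed
  have "ereal (\<eta> \<bullet> q + \<beta> \<bullet> v) \<le> z_LP P \<eta> \<beta>"
    unfolding z_LP_eq lp_feas_def
    using weak_duality[OF data_carriers(2,4) \<eta> data_carriers(6) nonpos v(1) dual]
    by (auto intro!: INF_greatest)
  then have "ereal (\<eta> \<bullet> q + \<beta> \<bullet> v) = z_LP P \<eta> \<beta>"
    using v(3) comm_scalar_prod[OF qc \<eta>] z_LP by simp
  then show ?thesis
    using nonpos v(1) dual unfolding dual_opt_proj_def \<eta>_def \<beta>_def by blast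
qed

section \<open>Optimal dual solutions give local subgradients\<close>

text \<open>
  Dual feasibility does not depend on the right-hand side. A dual solution optimal at \<open>\<zeta>\<close> therefore
  stays feasible at \<open>\<zeta>'\<close>, where its objective has changed by exactly \<open>q \<bullet> (\<zeta>' - \<zeta>)\<close>.
\<close>

lemma dual_opt_proj_supports_obj:
  assumes q: "q \<in> dual_opt_proj P (resid_rhs P \<zeta> x\<^sub>I) (resid_eq_rhs P x\<^sub>I)"
    and \<zeta>: "\<zeta> \<in> carrier_vec (num_restr P)" and z0: "restr_value P \<zeta> = ereal z0"
    and opt: "x\<^sub>I \<in> opt_int_parts P \<zeta>"
    and \<zeta>': "\<zeta>' \<in> carrier_vec (num_restr P)" and feas: "(x\<^sub>I, x\<^sub>C) \<in> feas_set P \<zeta>'"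
  shows "z0 + q \<bullet> (\<zeta>' - \<zeta>) \<le> obj P x\<^sub>I x\<^sub>C"
proof -
  define \<eta> where "\<eta> = resid_rhs P \<zeta> x\<^sub>I"
  define \<eta>' where "\<eta>' = resid_rhs P \<zeta>' x\<^sub>I"
  define \<beta> where "\<beta> = resid_eq_rhs P x\<^sub>I"
  obtain v where nonpos: "q \<in> nonpos_vecs (num_restr P)" and v: "v \<in> carrier_vec (num_eqs P)"
    and dual: "transpose_mat (C\<^sub>C P) *\<^sub>v q + transpose_mat (A\<^sub>C P) *\<^sub>v v \<le> c0\<^sub>C P"
    and tight: "ereal (\<eta> \<bullet> q + \<beta> \<bullet> v) = z_LP P \<eta> \<beta>"
    using q by (auto simp: dual_opt_proj_def \<eta>_def \<beta>_def)
  note qc = nonpos_vecsD(1)[OF nonpos]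
  have \<eta>: "\<eta> \<in> carrier_vec (num_restr P)" and \<eta>': "\<eta>' \<in> carrier_vec (num_restr P)"
    unfolding \<eta>_def \<eta>'_def by (rule resid_carriers[OF \<zeta>] resid_carriers[OF \<zeta>'])+
  have "x\<^sub>C \<in> lp_feas P \<eta>' \<beta>"
    using feas feas_set_iff_lp_feas[OF \<zeta>'] by (simp add: \<eta>'_def \<beta>_def)
  then have "\<eta>' \<bullet> q + \<beta> \<bullet> v \<le> c0\<^sub>C P \<bullet> x\<^sub>C"
    using weak_duality[OF data_carriers(2,4) \<eta>' data_carriers(6) nonpos v dual]
    by (auto simp: lp_feas_def)
  moreover have "\<eta> \<bullet> q + \<beta> \<bullet> v = z0 - c0\<^sub>I P \<bullet> x\<^sub>I"
    using tight z_LP_at_optimal_int_part[OF opt z0] by (simp add: \<eta>_def \<beta>_def)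
  moreover have "\<zeta>' - \<zeta> = \<eta>' - \<eta>"
    using \<zeta> \<zeta>' data_carriers(3) by (auto simp: \<eta>_def \<eta>'_def)
  then have "q \<bullet> (\<zeta>' - \<zeta>) = \<eta>' \<bullet> q - \<eta> \<bullet> q"
    using qc \<eta> \<eta>' by (simp add: scalar_prod_minus_distrib[of _ "num_restr P"]
        comm_scalar_prod[of q "num_restr P"])
  ultimately show ?thesis by (simp add: obj_def)
qed

lemma attaining_int_part_optimal:
  assumes \<zeta>: "\<zeta> \<in> carrier_vec (num_restr P)" and z0: "restr_value P \<zeta> = ereal z0"
    and x: "(x\<^sub>I, x\<^sub>C) \<in> feas_set P \<zeta>" and le: "obj P x\<^sub>I x\<^sub>C \<le> z0"
  shows "x\<^sub>I \<in> opt_int_parts P \<zeta>"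
proof -
  define \<eta> where "\<eta> = resid_rhs P \<zeta> x\<^sub>I"
  define \<beta> where "\<beta> = resid_eq_rhs P x\<^sub>I"
  define w where "w = z0 - c0\<^sub>I P \<bullet> x\<^sub>I"
  have int: "x\<^sub>I \<in> nonneg_int_vecs (num_int P)" and xC: "x\<^sub>C \<in> lp_feas P \<eta> \<beta>"
    using x feas_set_iff_lp_feas[OF \<zeta>] by (simp_all add: \<eta>_def \<beta>_def)
  have "ereal w \<le> z_LP P \<eta> \<beta>"
    unfolding z_LP_eq
  proof (rule INF_greatest)
    fix y assume "y \<in> lp_feas P \<eta> \<beta>"
    then have "(x\<^sub>I, y) \<in> feas_set P \<zeta>"
      using feas_set_iff_lp_feas[OF \<zeta>] int by (simp add: \<eta>_def \<beta>_def)
    then have "z0 \<le> obj P x\<^sub>I y"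
      using restr_value_le_obj[of x\<^sub>I y \<zeta>] z0 by simp
    then show "ereal w \<le> ereal (c0\<^sub>C P \<bullet> y)"
      by (simp add: w_def obj_def)
  qed
  moreover have "z_LP P \<eta> \<beta> \<le> ereal w"
    unfolding z_LP_eq using le by (intro INF_lower2[OF xC]) (simp add: w_def obj_def)
  ultimately have "z_LP P \<eta> \<beta> = ereal w" by simp
  then have "z_bar P \<zeta> x\<^sub>I = restr_value P \<zeta>"
    by (simp add: z_bar_def z0 \<eta>_def \<beta>_def w_def)
  then show ?thesis
    using x by (auto simp: opt_int_parts_def int_parts_at_def)
qed

text \<open>
  Lower semicontinuity of the piece of \<open>x\<^sub>I\<close> at \<open>\<zeta>\<close>, obtained with an explicit radius: it is small
  enough for each constraint and the affine bound to move by at most the margin \<open>e\<close> that the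
  linear program tolerates.
\<close>

lemma nonoptimal_int_part_locally_dominated:
  assumes \<zeta>: "\<zeta> \<in> carrier_vec (num_restr P)" and z0: "restr_value P \<zeta> = ereal z0"
    and not_opt: "x\<^sub>I \<notin> opt_int_parts P \<zeta>"
    and q: "q \<in> carrier_vec (num_restr P)"
  shows "\<exists>r>0. \<forall>\<zeta>'\<in>carrier_vec (num_restr P). euclid_norm (\<zeta>' - \<zeta>) \<le> r \<longrightarrow>
    (\<forall>x\<^sub>C. (x\<^sub>I, x\<^sub>C) \<in> feas_set P \<zeta>' \<longrightarrow> z0 + q \<bullet> (\<zeta>' - \<zeta>) \<le> obj P x\<^sub>I x\<^sub>C)"
proof (cases "x\<^sub>I \<in> nonneg_int_vecs (num_int P)")
  case False
  then show ?thesis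
    by (intro exI[of _ 1]) (auto simp: feas_set_def X_MO_def)
next
  case int: True
  define \<eta> where "\<eta> = resid_rhs P \<zeta> x\<^sub>I"
  define \<beta> where "\<beta> = resid_eq_rhs P x\<^sub>I"
  define w where "w = z0 - c0\<^sub>I P \<bullet> x\<^sub>I"
  have \<eta>: "\<eta> \<in> carrier_vec (num_restr P)" and \<beta>: "\<beta> \<in> carrier_vec (num_eqs P)"
    unfolding \<eta>_def \<beta>_def by (rule resid_carriers[OF \<zeta>])+
  have "w < c0\<^sub>C P \<bullet> x" if x: "x \<in> lp_feas P \<eta> \<beta>" for x
  proof (rule ccontr)
    assume "\<not> w < c0\<^sub>C P \<bullet> x"
    then have "obj P x\<^sub>I x \<le> z0" by (simp add: w_def obj_def)
    moreover have "(x\<^sub>I, x) \<in> feas_set P \<zeta>"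
      using feas_set_iff_lp_feas[OF \<zeta>] int x by (simp add: \<eta>_def \<beta>_def)
    ultimately show False
      using attaining_int_part_optimal[OF \<zeta> z0] not_opt by blast
  qed
  then have "\<exists>e>0. \<forall>x\<in>nonneg_vecs (num_cont P). A\<^sub>C P *\<^sub>v x = \<beta> \<longrightarrow>
      (\<forall>k<num_restr P. (C\<^sub>C P *\<^sub>v x) $ k \<le> \<eta> $ k + e) \<longrightarrow> w + e < c0\<^sub>C P \<bullet> x"
    by (intro lp_strict_bound_stable[OF data_carriers(2,4) \<eta> \<beta> data_carriers(6)])
      (simp add: lp_feas_def)
  then obtain e where e: "e > 0"
    and stable: "\<And>x. x \<in> nonneg_vecs (num_cont P) \<Longrightarrow> A\<^sub>C P *\<^sub>v x = \<beta> \<Longrightarrow>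
      (\<And>k. k < num_restr P \<Longrightarrow> (C\<^sub>C P *\<^sub>v x) $ k \<le> \<eta> $ k + e) \<Longrightarrow> w + e < c0\<^sub>C P \<bullet> x"
    by blast
  define K where "K = (\<Sum>k<num_restr P. \<bar>q $ k\<bar>)"
  define r where "r = e / (1 + K)"
  have K: "K \<ge> 0" by (simp add: K_def sum_nonneg)
  have r: "r > 0" "r \<le> e" "K * r \<le> e"
    using e K by (simp_all add: r_def field_simps)
  have "z0 + q \<bullet> (\<zeta>' - \<zeta>) \<le> obj P x\<^sub>I x\<^sub>C"
    if \<zeta>': "\<zeta>' \<in> carrier_vec (num_restr P)" and near: "euclid_norm (\<zeta>' - \<zeta>) \<le> r"
      and feas: "(x\<^sub>I, x\<^sub>C) \<in> feas_set P \<zeta>'" for \<zeta>' x\<^sub>C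
  proof -
    have d: "\<zeta>' - \<zeta> \<in> carrier_vec (num_restr P)" using \<zeta> \<zeta>' by simp
    have x: "x\<^sub>C \<in> lp_feas P (resid_rhs P \<zeta>' x\<^sub>I) \<beta>"
      using feas feas_set_iff_lp_feas[OF \<zeta>'] by (simp add: \<beta>_def)
    have "(C\<^sub>C P *\<^sub>v x\<^sub>C) $ k \<le> \<eta> $ k + e" if k: "k < num_restr P" for k
    proof -
      have "C\<^sub>C P *\<^sub>v x\<^sub>C \<le> resid_rhs P \<zeta>' x\<^sub>I" using x by (simp add: lp_feas_def)
      then have "(C\<^sub>C P *\<^sub>v x\<^sub>C) $ k \<le> resid_rhs P \<zeta>' x\<^sub>I $ k"
        using less_eq_vecD(2) resid_carriers(1)[OF \<zeta>'] k by blast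
      moreover have "resid_rhs P \<zeta>' x\<^sub>I $ k = \<eta> $ k + (\<zeta>' - \<zeta>) $ k"
        using k \<zeta> \<zeta>' data_carriers(3) by (simp add: \<eta>_def)
      moreover have "(\<zeta>' - \<zeta>) $ k \<le> e"
        using component_le_euclid_norm[OF d k] near r by linarith
      ultimately show ?thesis by linarith
    qed
    then have "w + e < c0\<^sub>C P \<bullet> x\<^sub>C"
      using x by (intro stable) (simp_all add: lp_feas_def)
    moreover have "q \<bullet> (\<zeta>' - \<zeta>) \<le> K * euclid_norm (\<zeta>' - \<zeta>)"
      unfolding K_def by (rule scalar_prod_le_euclid_norm[OF q d])
    then have "q \<bullet> (\<zeta>' - \<zeta>) \<le> e"
      using mult_left_mono[OF near K] r by linarith
    ultimately show ?thesis by (simp add: w_def obj_def)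
  qed
  with r(1) show ?thesis by blast
qed

end

section \<open>The local subdifferential\<close>

theorem proposition5:
  fixes P :: mo_data and S_min :: "real vec set" and \<zeta> :: "real vec"
  assumes "rational_mo_data P"
    and "bounded_X_MO P"
    and "minimal_description P S_min"
    and "\<zeta> \<in> feas_rhs P"
  shows "local_subdifferential (num_restr P) (restr_value P) \<zeta> =
    (\<Inter>x\<^sub>I \<in> opt_int_parts P \<zeta> \<inter> S_min.
       dual_opt_proj P (\<zeta> - C\<^sub>I P *\<^sub>v x\<^sub>I) (eq_rhs P - A\<^sub>I P *\<^sub>v x\<^sub>I))"
    (is "?L = ?R")
proof
  have desc: "S_min \<subseteq> int_parts P"
    "\<And>\<zeta>'. \<zeta>' \<in> feas_rhs P \<Longrightarrow> \<exists>x\<^sub>I \<in> S_min. \<exists>x\<^sub>C. (x\<^sub>I, x\<^sub>C) \<in> feas_set P \<zeta>' \<and>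
      ereal (obj P x\<^sub>I x\<^sub>C) = restr_value P \<zeta>'"
    using assms(3) unfolding minimal_description_def description_def by blast+
  have \<zeta>: "\<zeta> \<in> carrier_vec (num_restr P)"
    using assms(4) by (simp add: feas_rhs_def)
  obtain y\<^sub>I y\<^sub>C where y: "y\<^sub>I \<in> S_min" "(y\<^sub>I, y\<^sub>C) \<in> feas_set P \<zeta>"
    "ereal (obj P y\<^sub>I y\<^sub>C) = restr_value P \<zeta>"
    using desc(2)[OF assms(4)] by blast
  define z0 where "z0 = obj P y\<^sub>I y\<^sub>C"
  have z0: "restr_value P \<zeta> = ereal z0"
    using y(3) by (simp add: z0_def)
  show "?L \<subseteq> ?R"
    using local_subgradient_in_dual_opt_proj[OF assms(1) _ \<zeta> z0]
    by (auto simp: local_subdifferential_def)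
  show "?R \<subseteq> ?L"
  proof
    fix q assume qR: "q \<in> ?R"
    have y_opt: "y\<^sub>I \<in> opt_int_parts P \<zeta>"
      using attaining_int_part_optimal[OF assms(1) \<zeta> z0 y(2)] by (simp add: z0_def)
    have q: "q \<in> carrier_vec (num_restr P)"
      using qR y(1) y_opt by (auto simp: dual_opt_proj_def dest: nonpos_vecsD(1))
    have "\<exists>r>0. \<forall>\<zeta>'\<in>carrier_vec (num_restr P). euclid_norm (\<zeta>' - \<zeta>) \<le> r \<longrightarrow>
      (\<forall>x\<^sub>C. (x\<^sub>I, x\<^sub>C) \<in> feas_set P \<zeta>' \<longrightarrow> z0 + q \<bullet> (\<zeta>' - \<zeta>) \<le> obj P x\<^sub>I x\<^sub>C)"
      if "x\<^sub>I \<in> S_min" for x\<^sub>I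
    proof (cases "x\<^sub>I \<in> opt_int_parts P \<zeta>")
      case True
      then show ?thesis
        using dual_opt_proj_supports_obj[OF assms(1) _ \<zeta> z0 True] qR that
        by (intro exI[of _ 1]) auto
    next
      case False
      then show ?thesis
        by (rule nonoptimal_int_part_locally_dominated[OF assms(1) \<zeta> z0 _ q])
    qed
    then obtain r where r: "\<And>x\<^sub>I. x\<^sub>I \<in> S_min \<Longrightarrow> 0 < r x\<^sub>I"
      "\<And>x\<^sub>I \<zeta>' x\<^sub>C. x\<^sub>I \<in> S_min \<Longrightarrow> \<zeta>' \<in> carrier_vec (num_restr P) \<Longrightarrow>
        euclid_norm (\<zeta>' - \<zeta>) \<le> r x\<^sub>I \<Longrightarrow> (x\<^sub>I, x\<^sub>C) \<in> feas_set P \<zeta>' \<Longrightarrow>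
        z0 + q \<bullet> (\<zeta>' - \<zeta>) \<le> obj P x\<^sub>I x\<^sub>C"
      by metis
    have fin: "finite S_min"
      using finite_subset[OF desc(1) finite_int_parts[OF assms(2)]] .
    define e where "e = Min (r ` S_min)"
    have e: "e > 0"
      unfolding e_def using fin y(1) r(1) by (subst Min_gr_iff) auto
    have "restr_value P \<zeta> + ereal (q \<bullet> (\<zeta>' - \<zeta>)) \<le> restr_value P \<zeta>'"
      if \<zeta>': "\<zeta>' \<in> carrier_vec (num_restr P)" and near: "euclid_norm (\<zeta>' - \<zeta>) \<le> e" for \<zeta>'
    proof (cases "\<zeta>' \<in> feas_rhs P")
      case True
      then obtain x\<^sub>I x\<^sub>C where x: "x\<^sub>I \<in> S_min" "(x\<^sub>I, x\<^sub>C) \<in> feas_set P \<zeta>'"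
        "ereal (obj P x\<^sub>I x\<^sub>C) = restr_value P \<zeta>'"
        using desc(2) by blast
      have "e \<le> r x\<^sub>I"
        using fin x(1) by (simp add: e_def)
      then have "z0 + q \<bullet> (\<zeta>' - \<zeta>) \<le> obj P x\<^sub>I x\<^sub>C"
        using r(2)[OF x(1) \<zeta>' _ x(2)] near by simp
      then show ?thesis
        unfolding z0 x(3)[symmetric] by simp
    next
      case False
      then have "feas_set P \<zeta>' = {}"
        using \<zeta>' by (simp add: feas_rhs_def)
      then show ?thesis by (simp add: restr_value_def top_ereal_def)
    qed
    then have "local_subgradient (num_restr P) (restr_value P) \<zeta> q"
      unfolding local_subgradient_def using q e by blast
    then show "q \<in> ?L" by (simp add: local_subdifferential_def)
  qed
qed

end
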